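(* Let $T \in \mathscr{T}_{max}$ with $n = |V(T)| \ge 3$, and let $v \in V(T)$. Then $T - \{v\} \in \mathscr{T}_{max}$ if and only if either $v$ is a leaf whose support vertex is adjacent to at least one other leaf, or $v$ is a leaf whose support vertex has degree 2.
   Context: A leaf is a vertex of degree 1; a support vertex is a vertex adjacent to a leaf. $N(v)$ denotes the open neighborhood of $v$. A set $S \subseteq V(G)$ is a locating-dominating (LD) set if for all $u,v \in V(G)-S$: $N(v)\cap S \neq \varnothing$, and if $u \ne v$ then $N(v) \cap S \neq N(u) \cap S$. A RED:LD set is an LD set $S$ such that $S-\{v\}$ is an LD set for every $v \in S$. $\textrm{RED:LD}(G)$ is the minimum cardinality of a RED:LD set of $G$. $\mathscr{T}_{max}$ is the family of all trees $T$ of order $n \ge 2$ with $\textrm{RED:LD}(T) = n$ (a graph that is not a tree is not in $\mathscr{T}_{max}$). *)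

theory Defs
  imports "Graph_Theory.Digraph_Component"
begin

text \<open>
  A finite simple undirected graph is a digraph satisfying the locale predicate \<^const>\<open>graph\<close>:
  finite, loop-free, without parallel arcs and symmetric, so that each undirected edge is
  represented by two opposite arcs. In such a graph the degree of a vertex is its
  \<^const>\<open>out_degree\<close>.
\<close>

definition nbhd :: "('a, 'b) pre_digraph \<Rightarrow> 'a \<Rightarrow> 'a set" where
  "nbhd G v = {u. v \<rightarrow>\<^bsub>G\<^esub> u}"

definition leaf :: "('a, 'b) pre_digraph \<Rightarrow> 'a \<Rightarrow> bool" where
  "leaf G v \<longleftrightarrow> v \<in> verts G \<and> out_degree G v = 1"

definition support_vertex :: "('a, 'b) pre_digraph \<Rightarrow> 'a \<Rightarrow> bool" where
  "support_vertex G s \<longleftrightarrow> s \<in> verts G \<and> (\<exists>l\<in>nbhd G s. leaf G l)"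

text \<open>
  The library's \<^const>\<open>tree\<close> is not suitable here: it forbids every directed cycle, hence also the
  walk going along an edge and back. A cycle of an undirected simple graph has length at least 3.
\<close>

definition undirected_tree :: "('a, 'b) pre_digraph \<Rightarrow> bool" where
  "undirected_tree G \<longleftrightarrow>
     graph G \<and> connected G \<and> \<not> (\<exists>p. pre_digraph.cycle G p \<and> length p \<ge> 3)"

definition LD_set :: "('a, 'b) pre_digraph \<Rightarrow> 'a set \<Rightarrow> bool" where
  "LD_set G S \<longleftrightarrow> S \<subseteq> verts G \<and>
     (\<forall>u \<in> verts G - S. \<forall>v \<in> verts G - S.
        nbhd G v \<inter> S \<noteq> {} \<and> (u \<noteq> v \<longrightarrow> nbhd G v \<inter> S \<noteq> nbhd G u \<inter> S))"

definition RED_LD_set :: "('a, 'b) pre_digraph \<Rightarrow> 'a set \<Rightarrow> bool" where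
  "RED_LD_set G S \<longleftrightarrow> LD_set G S \<and> (\<forall>v\<in>S. LD_set G (S - {v}))"

text \<open>
  The minimum is taken over a nonempty set whenever \<open>G\<close> has no isolated vertex, since then
  \<open>verts G\<close> itself is a RED:LD set; this covers all trees of order at least 2.
\<close>

definition RED_LD :: "('a, 'b) pre_digraph \<Rightarrow> nat" where
  "RED_LD G = Min {card S | S. RED_LD_set G S}"

definition T_max :: "('a, 'b) pre_digraph set" where
  "T_max = {T. undirected_tree T \<and> card (verts T) \<ge> 2 \<and> RED_LD T = card (verts T)}"

end

theory Submission
  imports Defs
begin

text \<open>
  A superset of a RED:LD set is again one, so \<open>RED:LD(T) = n\<close> says that no single vertex \<open>x\<close> can be
  dropped from \<open>V(T)\<close>. The obstruction is a second vertex \<open>y\<close> such that \<open>x\<close> is a leaf at \<open>y\<close>,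
  \<open>y\<close> is a leaf at \<open>x\<close>, or \<open>x\<close> and \<open>y\<close> are twins; in a tree twins are leaves. Hence a tree of order
  at least 2 is in the family iff each of its vertices is a leaf or a support vertex. Deleting \<open>v\<close>
  leaves a tree iff \<open>v\<close> is a leaf, and then only the support vertex of \<open>v\<close> can lose this property.
\<close>

section \<open>Monotonicity of LD and RED:LD sets\<close>

text \<open>Enlarging \<open>S\<close> leaves fewer vertices to check, and two traces that agree on
  \<open>S'\<close> also agree on \<open>S\<close>.\<close>

lemma LD_set_mono:
  assumes "LD_set G S" "S \<subseteq> S'" "S' \<subseteq> verts G"
  shows "LD_set G S'"
  unfolding LD_set_def
proof (intro conjI ballI impI)
  fix u v assume uv: "u \<in> verts G - S'" "v \<in> verts G - S'"
  then have S: "u \<in> verts G - S" "v \<in> verts G - S" using assms(2) by auto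
  then have "nbhd G v \<inter> S \<noteq> {}" using assms(1) unfolding LD_set_def by blast
  then show "nbhd G v \<inter> S' \<noteq> {}" using assms(2) by blast
  show "nbhd G v \<inter> S' \<noteq> nbhd G u \<inter> S'" if "u \<noteq> v"
  proof -
    have "nbhd G v \<inter> S \<noteq> nbhd G u \<inter> S"
      using S that assms(1) unfolding LD_set_def by blast
    then show ?thesis using assms(2) by blast
  qed
qed (use assms in auto)

text \<open>For \<open>x\<close> in \<open>S\<close> the set \<open>S' - {x}\<close> contains
  \<open>S - {x}\<close>, and for \<open>x\<close> outside \<open>S\<close> it contains
  \<open>S\<close> itself; both are LD sets.\<close>

lemma RED_LD_set_mono:
  assumes "RED_LD_set G S" "S \<subseteq> S'" "S' \<subseteq> verts G"
  shows "RED_LD_set G S'"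
  unfolding RED_LD_set_def
proof (intro conjI ballI)
  have LD: "LD_set G S" using assms(1) by (simp add: RED_LD_set_def)
  then show "LD_set G S'" using assms(2,3) by (rule LD_set_mono)
  fix x assume "x \<in> S'"
  show "LD_set G (S' - {x})"
  proof (cases "x \<in> S")
    case True
    then have "LD_set G (S - {x})" using assms(1) by (simp add: RED_LD_set_def)
    then show ?thesis by (rule LD_set_mono) (use assms in auto)
  next
    case False
    show ?thesis using LD by (rule LD_set_mono) (use assms False in auto)
  qed
qed

section \<open>Neighbourhoods, leaves and vertex deletion in simple graphs\<close>

context graph
begin

lemma nbhd_sym: "u \<in> nbhd G v \<Longrightarrow> v \<in> nbhd G u"
  unfolding nbhd_def using arcs_ends_symmetric[OF sym_arcs] by auto

lemma nbhd_in_verts: "u \<in> nbhd G v \<Longrightarrow> u \<in> verts G"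
  by (auto simp: nbhd_def)

lemma not_in_nbhd: "v \<notin> nbhd G v"
  unfolding nbhd_def using adj_not_same by auto

lemma finite_nbhd: "finite (nbhd G v)"
  using nbhd_in_verts finite_verts by (metis finite_subset subsetI)

text \<open>Without parallel arcs, an arc leaving \<open>v\<close> is determined by its
  head.\<close>

lemma out_degree_eq_card_nbhd: "out_degree G v = card (nbhd G v)"
proof -
  have "nbhd G v = head G ` out_arcs G v"
    by (auto simp: nbhd_def arcs_ends_conv)
  moreover have "inj_on (head G) (out_arcs G v)"
    by (rule inj_onI) (auto intro: no_multi_arcs simp: arc_to_ends_def)
  ultimately show ?thesis by (simp add: out_degree_def card_image)
qed

lemma leaf_iff_nbhd: "leaf G v \<longleftrightarrow> (\<exists>s. nbhd G v = {s})"
proof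
  assume "\<exists>s. nbhd G v = {s}"
  then obtain s where s: "nbhd G v = {s}" by blast
  then have "v \<in> verts G" using nbhd_sym nbhd_in_verts by blast
  then show "leaf G v" by (simp add: leaf_def out_degree_eq_card_nbhd s)
qed (auto simp: leaf_def out_degree_eq_card_nbhd card_1_singleton_iff)

lemma graph_del_vert: "graph (del_vert v)"
proof -
  have sub: "subgraph (del_vert v) G" by (rule subgraph_del_vert)
  have "digraph (del_vert v)" using sub by (rule digraph_subgraph)
  moreover have "symmetric (del_vert v)"
    using sym_arcs by (fastforce simp: symmetric_conv del_vert_simps)
  ultimately show ?thesis by (rule digraph.graphI)
qed

lemma nbhd_del_vert: "u \<noteq> v \<Longrightarrow> nbhd (del_vert v) u = nbhd G u - {v}"
  by (auto simp: nbhd_def arcs_ends_conv del_vert_simps)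

section \<open>Graphs whose RED:LD number is the order\<close>

text \<open>Only \<open>x\<close> lies outside \<open>verts G - {x}\<close>, so there is nothing to
  separate, and a neighbour of \<open>x\<close> dominates it.\<close>

lemma RED_LD_set_verts:
  assumes "\<And>x. x \<in> verts G \<Longrightarrow> nbhd G x \<noteq> {}"
  shows "RED_LD_set G (verts G)"
proof -
  have "nbhd G x \<inter> (verts G - {x}) \<noteq> {}" if "x \<in> verts G" for x
    using assms[OF that] nbhd_in_verts[of _ x] not_in_nbhd[of x] by auto
  then show ?thesis by (auto simp: RED_LD_set_def LD_set_def)
qed

text \<open>By monotonicity a RED:LD set that misses \<open>x\<close> extends to
  \<open>verts G - {x}\<close>, so only complements of single vertices matter. As no vertex is
  isolated, \<open>verts G\<close> is a RED:LD set and the minimum is over a nonempty set.\<close>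

lemma RED_LD_eq_order_iff:
  assumes "\<And>x. x \<in> verts G \<Longrightarrow> nbhd G x \<noteq> {}"
  shows "RED_LD G = card (verts G) \<longleftrightarrow> (\<forall>x\<in>verts G. \<not> RED_LD_set G (verts G - {x}))"
proof -
  let ?C = "{card S | S. RED_LD_set G S}"
  have sub: "S \<subseteq> verts G" if "RED_LD_set G S" for S
    using that by (simp add: RED_LD_set_def LD_set_def)
  then have "?C \<subseteq> {..card (verts G)}" by (auto intro!: card_mono[OF finite_verts])
  then have fin: "finite ?C" by (rule finite_subset) simp
  have V: "card (verts G) \<in> ?C" using RED_LD_set_verts[OF assms] by auto
  show ?thesis
  proof
    assume eq: "RED_LD G = card (verts G)"
    show "\<forall>x\<in>verts G. \<not> RED_LD_set G (verts G - {x})"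
    proof (intro ballI notI)
      fix x assume x: "x \<in> verts G" and "RED_LD_set G (verts G - {x})"
      then have "card (verts G - {x}) \<in> ?C" by blast
      then have "card (verts G) \<le> card (verts G - {x})"
        using Min_le[OF fin] eq by (simp add: RED_LD_def)
      then show False using card_Diff1_less[OF finite_verts x] by simp
    qed
  next
    assume no: "\<forall>x\<in>verts G. \<not> RED_LD_set G (verts G - {x})"
    have "S = verts G" if S: "RED_LD_set G S" for S
    proof (rule ccontr)
      assume "S \<noteq> verts G"
      then obtain x where x: "x \<in> verts G" "x \<notin> S" using sub[OF S] by blast
      have "RED_LD_set G (verts G - {x})"
        using S by (rule RED_LD_set_mono) (use x sub[OF S] in auto)
      then show False using no x by blast
    qed
    then have "?C = {card (verts G)}" using V by auto
    then show "RED_LD G = card (verts G)" by (simp add: RED_LD_def)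
  qed
qed

text \<open>Once \<open>y\<close> is removed as well, just \<open>x\<close> and \<open>y\<close> lie
  outside the set. The three conjuncts say that \<open>x\<close> is dominated, that \<open>y\<close>
  is dominated, and that the two are separated.\<close>

lemma RED_LD_set_verts_minus_iff:
  assumes "\<And>x. x \<in> verts G \<Longrightarrow> nbhd G x \<noteq> {}" and x: "x \<in> verts G"
  shows "RED_LD_set G (verts G - {x}) \<longleftrightarrow>
    (\<forall>y\<in>verts G - {x}. \<not> nbhd G x \<subseteq> {y} \<and> \<not> nbhd G y \<subseteq> {x} \<and> nbhd G x - {y} \<noteq> nbhd G y - {x})"
proof -
  have 1: "LD_set G (verts G - {x})"
    using RED_LD_set_verts[OF assms(1)] x by (simp add: RED_LD_set_def)
  have 2: "LD_set G (verts G - {x} - {y}) \<longleftrightarrow>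
      \<not> nbhd G x \<subseteq> {y} \<and> \<not> nbhd G y \<subseteq> {x} \<and> nbhd G x - {y} \<noteq> nbhd G y - {x}"
    if y: "y \<in> verts G - {x}" for y
  proof -
    have V: "verts G - (verts G - {x} - {y}) = {x, y}" using x y by auto
    have "nbhd G x \<inter> (verts G - {x} - {y}) = nbhd G x - {y}"
      "nbhd G y \<inter> (verts G - {x} - {y}) = nbhd G y - {x}"
      using nbhd_in_verts not_in_nbhd by auto
    then show ?thesis unfolding LD_set_def V using y by auto
  qed
  show ?thesis unfolding RED_LD_set_def using 1 2 by blast
qed

section \<open>Connectedness and deletion of a leaf\<close>

lemma connected_iff_reachable:
  "connected G \<longleftrightarrow> verts G \<noteq> {} \<and> (\<forall>u\<in>verts G. \<forall>v\<in>verts G. u \<rightarrow>\<^sup>* v)"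
  by (simp add: connected_def strongly_connected_def reachable_mk_symmetric_eq[OF sym_arcs])

lemma connected_nbhd_nonempty:
  assumes "connected G" "card (verts G) \<ge> 2" "x \<in> verts G"
  shows "nbhd G x \<noteq> {}"
proof -
  have "\<not> verts G \<subseteq> {x}" using assms(2) card_mono[of "{x}" "verts G"] by auto
  then obtain y where y: "y \<in> verts G" "y \<noteq> x" by blast
  then have "x \<rightarrow>\<^sup>* y" using assms by (simp add: connected_iff_reachable)
  then obtain z where "x \<rightarrow> z" using y(2) by (metis converse_reachable_cases)
  then show ?thesis by (auto simp: nbhd_def)
qed

lemma connected_del_leaf:
  assumes "connected G" and v: "nbhd G v = {s}"
  shows "connected (del_vert v)"
proof -
  interpret D: graph "del_vert v" by (rule graph_del_vert)
  have s: "s \<in> verts (del_vert v)" using v nbhd_in_verts not_in_nbhd by (auto simp: del_vert_simps)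
  text \<open>A walk that enters \<open>v\<close> comes from \<open>s\<close> and returns to \<open>s\<close>, so visits to \<open>v\<close> can be cut out.\<close>
  have "a \<rightarrow>\<^sup>*\<^bsub>del_vert v\<^esub> (if b = v then s else b)" if "a \<rightarrow>\<^sup>* b" and a: "a \<noteq> v" for a b
    using that(1)
  proof (induction rule: reachable_induct)
    case base
    then show ?case using a by (auto simp: del_vert_simps)
  next
    case (step x y)
    have xy: "y \<in> nbhd G x" using step by (simp add: nbhd_def)
    consider "x = v" "y = s" | "y = v" "x = s" "x \<noteq> v" | "x \<noteq> v" "y \<noteq> v"
      using xy v nbhd_sym[OF xy] not_in_nbhd by blast
    then show ?case
    proof cases
      case 3
      then have "y \<in> nbhd (del_vert v) x" using xy by (simp add: nbhd_del_vert)
      then show ?thesis using step.IH 3 by (auto simp: nbhd_def intro: D.reachable_adj_trans)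
    qed (use step.IH s in \<open>auto simp: del_vert_simps\<close>)
  qed
  then have "a \<rightarrow>\<^sup>*\<^bsub>del_vert v\<^esub> b"
    if "a \<in> verts (del_vert v)" "b \<in> verts (del_vert v)" for a b
    using that assms(1) by (metis DiffE connected_iff_reachable singletonI verts_del_vert)
  then show ?thesis using s by (auto simp: D.connected_iff_reachable)
qed

end

section \<open>Consequences of acyclicity\<close>

text \<open>A path from \<open>a\<close> to \<open>b\<close> that avoids \<open>v\<close> would
  close up through \<open>v\<close> to a cycle.\<close>

lemma undirected_tree_neighbours_separated:
  assumes T: "undirected_tree T" and ab: "a \<in> nbhd T v" "b \<in> nbhd T v" "a \<noteq> b"
  shows "\<not> a \<rightarrow>\<^sup>*\<^bsub>pre_digraph.del_vert T v\<^esub> b"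
proof
  interpret graph T using T by (simp add: undirected_tree_def)
  interpret D: graph "del_vert v" by (rule graph_del_vert)
  assume "a \<rightarrow>\<^sup>*\<^bsub>del_vert v\<^esub> b"
  then obtain p where p: "D.apath a p b" using D.reachable_apath by blast
  have pT: "apath a p b" using p subgraph_del_vert by (rule subgraph_apath_imp_apath)
  have "set (D.awalk_verts a p) \<subseteq> verts (del_vert v)"
    using p by (auto simp: D.apath_def dest: D.awalk_verts_in_verts)
  moreover have "D.awalk_verts a p = awalk_verts a p"
    using compatible_awalk_verts[of T "del_vert v"] subgraph_del_vert[of v]
    by (simp add: subgraph_def)
  ultimately have vp: "v \<notin> set (awalk_verts a p)" by (auto simp: del_vert_simps)
  obtain e where e: "e \<in> arcs T" "tail T e = v" "head T e = a"
    using ab(1) by (auto simp: nbhd_def)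
  obtain f where f: "f \<in> arcs T" "tail T f = b" "head T f = v"
    using nbhd_sym[OF ab(2)] by (auto simp: nbhd_def)
  \<comment> \<open>Besides \<open>e\<close> and \<open>f\<close> the closed walk thus has an arc of
    \<open>p\<close>, which gives length at least 3.\<close>
  have "p \<noteq> []" using pT ab(3) by (auto simp: apath_Nil_iff)
  have w: "awalk a p b" using pT by (simp add: apath_def)
  have w': "awalk a (p @ [f]) v"
    using w f by (auto simp: awalk_append_iff awalk_simps)
  have "awalk_verts a (p @ [f]) = awalk_verts a p @ [v]"
    using w f w' by (auto simp: awalk_verts_append)
  \<comment> \<open>\<open>cycle\<close> asks for distinct vertices after the first one; for the
    closed walk from \<open>v\<close> these are the vertices from \<open>a\<close> on.\<close>
  then have "distinct (awalk_verts a (p @ [f]))" using pT vp by (simp add: apath_def)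
  then have "cycle (e # p @ [f])"
    using w' e by (auto simp: cycle_def awalk_Cons_iff intro!: exI[of _ v])
  moreover have "length (e # p @ [f]) \<ge> 3" using \<open>p \<noteq> []\<close> by (cases p) auto
  ultimately show False using T by (auto simp: undirected_tree_def)
qed

text \<open>Otherwise the walk \<open>a\<close>, \<open>y\<close>, \<open>b\<close> would join two
  neighbours of \<open>x\<close> while avoiding \<open>x\<close>. This is what forces twins to be
  leaves.\<close>

lemma undirected_tree_common_neighbour_unique:
  assumes T: "undirected_tree T" and "a \<in> nbhd T x" "b \<in> nbhd T x"
    and "a \<in> nbhd T y" "b \<in> nbhd T y" "x \<noteq> y"
  shows "a = b"
proof (rule ccontr)
  interpret graph T using T by (simp add: undirected_tree_def)
  interpret D: graph "del_vert x" by (rule graph_del_vert)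
  assume ne: "a \<noteq> b"
  have ax: "a \<noteq> x" using assms not_in_nbhd by auto
  have "y \<in> nbhd (del_vert x) a" "b \<in> nbhd (del_vert x) y"
    using assms ax not_in_nbhd nbhd_sym by (auto simp: nbhd_del_vert)
  then have "a \<rightarrow>\<^sup>*\<^bsub>del_vert x\<^esub> b"
    by (auto simp: nbhd_def intro: D.reachable_adj_trans)
  then show False using undirected_tree_neighbours_separated[OF T assms(2,3) ne] by blast
qed

lemma undirected_tree_no_triangle:
  assumes T: "undirected_tree T" and "y \<in> nbhd T x" "z \<in> nbhd T x"
  shows "z \<notin> nbhd T y"
proof
  interpret graph T using T by (simp add: undirected_tree_def)
  interpret D: graph "del_vert x" by (rule graph_del_vert)
  assume z: "z \<in> nbhd T y"
  then have ne: "y \<noteq> z" using not_in_nbhd by auto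
  have "y \<noteq> x" "z \<noteq> x" using assms(2,3) not_in_nbhd by auto
  then have "z \<in> nbhd (del_vert x) y" using z by (simp add: nbhd_del_vert)
  then have "y \<rightarrow>\<^sup>*\<^bsub>del_vert x\<^esub> z" by (auto simp: nbhd_def)
  then show False using undirected_tree_neighbours_separated[OF T assms(2,3) ne] by blast
qed

section \<open>The trees in which every vertex is a leaf or a support vertex\<close>

lemma T_max_iff:
  "T \<in> T_max \<longleftrightarrow> undirected_tree T \<and> card (verts T) \<ge> 2 \<and>
    (\<forall>x\<in>verts T. leaf T x \<or> support_vertex T x)"
proof (cases "undirected_tree T \<and> card (verts T) \<ge> 2")
  case True
  then have T: "undirected_tree T" and n: "card (verts T) \<ge> 2" by auto
  interpret graph T using T by (simp add: undirected_tree_def)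
  have ne: "nbhd T x \<noteq> {}" if "x \<in> verts T" for x
    using connected_nbhd_nonempty n T that by (simp add: undirected_tree_def)
  have "\<not> RED_LD_set T (verts T - {x}) \<longleftrightarrow> leaf T x \<or> support_vertex T x" (is "?L \<longleftrightarrow> ?R")
    if x: "x \<in> verts T" for x
  proof
    assume ?L
    then obtain y where y: "y \<in> verts T" "y \<noteq> x" and
      "nbhd T x \<subseteq> {y} \<or> nbhd T y \<subseteq> {x} \<or> nbhd T x - {y} = nbhd T y - {x}"
      using RED_LD_set_verts_minus_iff[OF ne x] by auto
    then consider "nbhd T x = {y}" | "nbhd T y = {x}" | "nbhd T x - {y} = nbhd T y - {x}"
      using ne x by blast
    then show ?R
    proof cases
      case 1
      then show ?thesis by (auto simp: leaf_iff_nbhd)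
    next
      case 2
      then have "y \<in> nbhd T x" using nbhd_sym by blast
      then show ?thesis using 2 x by (auto simp: leaf_iff_nbhd support_vertex_def)
    next
      case 3
      show ?thesis
      proof (cases "y \<in> nbhd T x")
        case True
        \<comment> \<open>A further neighbour of \<open>x\<close> would by \<open>3\<close> be a
          neighbour of \<open>y\<close> too and close a triangle.\<close>
        then have "nbhd T x = {y}" using 3 undirected_tree_no_triangle[OF T True] by blast
        then show ?thesis by (auto simp: leaf_iff_nbhd)
      next
        case False
        then have eq: "nbhd T x = nbhd T y" using 3 nbhd_sym by blast
        obtain a where a: "a \<in> nbhd T x" using ne x by blast
        \<comment> \<open>The twins \<open>x\<close> and \<open>y\<close> share all their
          neighbours, but can have only one in common.\<close>
        then have "nbhd T x = {a}"
          using eq undirected_tree_common_neighbour_unique[OF T _ a _ _ y(2)[symmetric]] by blast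
        then show ?thesis by (auto simp: leaf_iff_nbhd)
      qed
    qed
  next
    assume ?R
    \<comment> \<open>The witness is the sole neighbour of the leaf \<open>x\<close>, or a leaf at
      the support vertex \<open>x\<close>.\<close>
    then obtain y where y: "y \<in> nbhd T x" "nbhd T x \<subseteq> {y} \<or> nbhd T y \<subseteq> {x}"
    proof
      assume "support_vertex T x"
      then obtain l s where "l \<in> nbhd T x" "nbhd T l = {s}"
        by (auto simp: support_vertex_def leaf_iff_nbhd)
      then have "l \<in> nbhd T x" "nbhd T l \<subseteq> {x}" using nbhd_sym[of l x] by auto
      then show thesis using that by blast
    qed (use that in \<open>auto simp: leaf_iff_nbhd\<close>)
    then have "y \<in> verts T - {x}" using nbhd_in_verts[OF y(1)] not_in_nbhd[of x] by auto
    then show ?L using y RED_LD_set_verts_minus_iff[OF ne x] by blast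
  qed
  then show ?thesis using True RED_LD_eq_order_iff[OF ne] by (simp add: T_max_def)
qed (auto simp: T_max_def)

section \<open>Deleting a vertex from a tree in the family\<close>

text \<open>If the rest is connected, two neighbours of \<open>v\<close> would be joined avoiding
  \<open>v\<close>, so \<open>v\<close> has just one. Conversely, deleting a leaf keeps
  connectedness, and a subgraph has no new cycles.\<close>

lemma undirected_tree_del_vert_iff:
  assumes T: "undirected_tree T" and v: "v \<in> verts T" and n: "card (verts T) \<ge> 2"
  shows "undirected_tree (pre_digraph.del_vert T v) \<longleftrightarrow> leaf T v"
proof
  interpret graph T using T by (simp add: undirected_tree_def)
  interpret D: graph "del_vert v" by (rule graph_del_vert)
  {
    assume "undirected_tree (del_vert v)"
    then have conn: "connected (del_vert v)" by (simp add: undirected_tree_def)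
    obtain s where s: "s \<in> nbhd T v"
      using connected_nbhd_nonempty[OF _ n v] T by (auto simp: undirected_tree_def)
    have "u = s" if u: "u \<in> nbhd T v" for u
    proof (rule ccontr)
      assume "u \<noteq> s"
      moreover have "u \<in> verts (del_vert v)" "s \<in> verts (del_vert v)"
        using u s nbhd_in_verts not_in_nbhd by (auto simp: verts_del_vert)
      then have "u \<rightarrow>\<^sup>*\<^bsub>del_vert v\<^esub> s"
        using conn by (simp add: D.connected_iff_reachable)
      ultimately show False using undirected_tree_neighbours_separated[OF T u s] by blast
    qed
    then have "nbhd T v = {s}" using s by blast
    then show "leaf T v" by (auto simp: leaf_iff_nbhd)
  next
    assume "leaf T v"
    then obtain s where "nbhd T v = {s}" by (auto simp: leaf_iff_nbhd)
    then have "connected (del_vert v)"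
      using connected_del_leaf T by (simp add: undirected_tree_def)
    moreover have "cycle p" if "D.cycle p" for p
      using subgraph_del_vert that by (rule subgraph_cycle)
    ultimately show "undirected_tree (del_vert v)"
      using T D.graph_axioms by (auto simp: undirected_tree_def)
  }
qed

theorem theorem11:
  fixes T :: "('a, 'b) pre_digraph" and v :: 'a
  assumes "T \<in> T_max"
    and "card (verts T) \<ge> 3"
    and "v \<in> verts T"
  shows "pre_digraph.del_vert T v \<in> T_max \<longleftrightarrow>
    (leaf T v \<and> (\<exists>s\<in>nbhd T v. support_vertex T s \<and> (\<exists>u\<in>nbhd T s. u \<noteq> v \<and> leaf T u))) \<or>
    (leaf T v \<and> (\<exists>s\<in>nbhd T v. support_vertex T s \<and> out_degree T s = 2))"
proof (cases "leaf T v")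
  case False
  then show ?thesis using assms undirected_tree_del_vert_iff[of T v] by (auto simp: T_max_iff)
next
  case True
  have T: "undirected_tree T" using assms by (simp add: T_max_def)
  interpret graph T using T by (simp add: undirected_tree_def)
  interpret D: graph "del_vert v" by (rule graph_del_vert)
  obtain s where s: "nbhd T v = {s}" using True by (auto simp: leaf_iff_nbhd)
  have sv: "v \<in> nbhd T s" "s \<noteq> v" using s nbhd_sym not_in_nbhd by auto
  have sV: "s \<in> verts T" using s nbhd_in_verts by auto
  have supp: "support_vertex T s" using True sV sv by (auto simp: support_vertex_def)
  have tree: "undirected_tree (del_vert v)"
    using undirected_tree_del_vert_iff[OF T assms(3)] assms(2) True by simp
  have n: "card (verts (del_vert v)) \<ge> 2" using assms(2,3) by (simp add: verts_del_vert)
  have D_ne: "nbhd (del_vert v) x \<noteq> {}" if "x \<in> verts (del_vert v)" for x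
    using D.connected_nbhd_nonempty[OF _ n that] tree by (simp add: undirected_tree_def)
  have nb: "nbhd (del_vert v) x = nbhd T x" if "x \<noteq> v" "x \<noteq> s" for x
    using that s nbhd_sym nbhd_del_vert by blast
  have leaf_D: "leaf (del_vert v) x \<longleftrightarrow> leaf T x" if "x \<noteq> v" "x \<noteq> s" for x
    using nb[OF that] by (simp add: leaf_iff_nbhd D.leaf_iff_nbhd)
  \<comment> \<open>At least two vertices remain after the deletion and they are connected, so
    \<open>s\<close> has a neighbour besides \<open>v\<close>.\<close>
  have s_not_leaf: "\<not> leaf T s"
    using sv D_ne[of s] sV nbhd_del_vert[of s v] by (auto simp: leaf_iff_nbhd verts_del_vert)
  \<comment> \<open>Leaves other than \<open>v\<close> keep their neighbourhood. A leaf
    \<open>l\<close> at \<open>x\<close> also survives as a leaf: it is not \<open>v\<close>, whose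
    only neighbour is \<open>s\<close>, and not \<open>s\<close>, which is no leaf.\<close>
  have other: "leaf (del_vert v) x \<or> support_vertex (del_vert v) x"
    if x: "x \<in> verts T" "x \<noteq> v" "x \<noteq> s" for x
  proof (cases "leaf T x")
    case False
    then have "support_vertex T x" using assms(1) x(1) by (auto simp: T_max_iff)
    then obtain l where l: "l \<in> nbhd T x" "leaf T l" by (auto simp: support_vertex_def)
    have "l \<noteq> v" using l(1) x(3) s nbhd_sym by blast
    moreover have "l \<noteq> s" using l(2) s_not_leaf by auto
    ultimately show ?thesis
      using l x leaf_D nb by (auto simp: support_vertex_def verts_del_vert)
  qed (use x leaf_D in auto)
  \<comment> \<open>Only \<open>s\<close> is left to check, and its two ways of qualifying give the
    two alternatives of the theorem.\<close>
  have "del_vert v \<in> T_max \<longleftrightarrow> leaf (del_vert v) s \<or> support_vertex (del_vert v) s"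
    using tree n other sV sv by (auto simp: T_max_iff verts_del_vert)
  also have "leaf (del_vert v) s \<longleftrightarrow> out_degree T s = 2"
  proof -
    \<comment> \<open>Losing \<open>v\<close> lowers the degree of \<open>s\<close> by one, so
      degree 2 before means degree 1 after.\<close>
    have "card (nbhd T s) = Suc (card (nbhd T s - {v}))"
      using sv finite_nbhd by (metis card_Suc_Diff1)
    moreover have "nbhd (del_vert v) s = nbhd T s - {v}" using sv by (simp add: nbhd_del_vert)
    ultimately show ?thesis
      using sv(2) sV
      by (simp add: leaf_def verts_del_vert D.out_degree_eq_card_nbhd out_degree_eq_card_nbhd
          del: card_Diff_singleton card_Diff_insert)
  qed
  also have "support_vertex (del_vert v) s \<longleftrightarrow> (\<exists>u\<in>nbhd T s. u \<noteq> v \<and> leaf T u)"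
    using sv(2) sV leaf_D nbhd_del_vert[of s v] not_in_nbhd[of s]
    by (auto simp: support_vertex_def verts_del_vert)
  finally show ?thesis using True s supp by auto
qed

end
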